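(* Let $G$ be a connected undirected graph on $N\ge 2$ nodes with positive link weights, and let $\mathcal{S}$ be its (original) simplex in $\mathbb{R}^{N-1}$. For every non-empty proper subset $\mathcal{V}$ of $\mathcal{N}=\{1,\dots,N\}$ with $V$ elements and complement $\bar{\mathcal{V}}=\mathcal{N}\setminus\mathcal{V}$, $$\Vert c_{\mathcal{V}}\Vert^2=\frac{\vert\partial\mathcal{V}\vert}{V^2}\qquad\text{and}\qquad \Vert c_{\bar{\mathcal{V}}}\Vert^2=\frac{\vert\partial\bar{\mathcal{V}}\vert}{(N-V)^2}.$$
   Context: The graph $G$ has node set $\mathcal{N}=\{1,\dots,N\}$, link set $\mathcal{L}$ (links join distinct nodes) and weights $w_{ij}=w_{ji}>0$ for $(i,j)\in\mathcal{L}$ (all equal to $1$ in the unweighted case). The Laplacian $Q$ is the $N\times N$ symmetric matrix with $(Q)_{ii}=d_i$, the sum of the weights of links incident to $i$, $(Q)_{ij}=-w_{ij}$ if $(i,j)\in\mathcal{L}$, and $(Q)_{ij}=0$ otherwise. Since $G$ is connected, $Q$ has eigenvalues $\mu_1\ge\dots\ge\mu_{N-1}>\mu_N=0$ with orthonormal eigenvectors $z_1,\dots,z_N$. The simplex $\mathcal{S}$ of $G$ is the convex hull of the vertices $s_1,\dots,s_N\in\mathbb{R}^{N-1}$ with $(s_i)_k=(z_k)_i\sqrt{\mu_k}$ for $k=1,\dots,N-1$ (so $s_i^Ts_j=(Q)_{ij}$). For non-empty $\mathcal{V}\subset\mathcal{N}$ with $V$ elements, $c_{\mathcal{V}}=\frac1V\sum_{i\in\mathcal{V}}s_i$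 is the centroid of the face with vertices $\{s_i\}_{i\in\mathcal{V}}$. The cut size $\vert\partial\mathcal{V}\vert$ is the total weight (number, in the unweighted case) of links with one endpoint in $\mathcal{V}$ and the other in $\mathcal{N}\setminus\mathcal{V}$. *)

theory Defs
  imports "HOL-Analysis.Analysis"
begin

text \<open>A graph on the node type \<open>'n\<close> is a set \<open>L\<close> of ordered pairs, each undirected link being
  represented by both of its orientations, with a weight function \<open>w\<close> whose values outside \<open>L\<close>
  are irrelevant.\<close>

definition weighted_graph :: "('n::finite \<times> 'n) set \<Rightarrow> ('n \<Rightarrow> 'n \<Rightarrow> real) \<Rightarrow> bool" where
  "weighted_graph L w \<longleftrightarrow> sym L \<and> irrefl L \<and> (\<forall>(i, j) \<in> L. w i j = w j i \<and> w i j > 0)"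

definition connected_graph :: "('n::finite \<times> 'n) set \<Rightarrow> bool" where
  "connected_graph L \<longleftrightarrow> (\<forall>i j. (i, j) \<in> L\<^sup>*)"

definition degree :: "('n::finite \<times> 'n) set \<Rightarrow> ('n \<Rightarrow> 'n \<Rightarrow> real) \<Rightarrow> 'n \<Rightarrow> real" where
  "degree L w i = (\<Sum>j | (i, j) \<in> L. w i j)"

definition laplacian :: "('n::finite \<times> 'n) set \<Rightarrow> ('n \<Rightarrow> 'n \<Rightarrow> real) \<Rightarrow> real ^ 'n ^ 'n" where
  "laplacian L w =
     (\<chi> i j. if i = j then degree L w i else if (i, j) \<in> L then - w i j else 0)"

text \<open>A link of the cut has exactly one orientation leading from \<open>V\<close> to its complement, so it is
  counted once.\<close>

definition cut_size :: "('n::finite \<times> 'n) set \<Rightarrow> ('n \<Rightarrow> 'n \<Rightarrow> real) \<Rightarrow> 'n set \<Rightarrow> real" where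
  "cut_size L w V = (\<Sum>(i, j) \<in> L \<inter> V \<times> (- V). w i j)"

text \<open>Eigenpairs are numbered \<open>1, \<dots>, CARD('n)\<close>; values of \<open>\<mu>\<close> and \<open>z\<close> at other indices are
  irrelevant.\<close>

definition ordered_orthonormal_eigensystem ::
  "real ^ 'n ^ 'n \<Rightarrow> (nat \<Rightarrow> real) \<Rightarrow> (nat \<Rightarrow> real ^ 'n::finite) \<Rightarrow> bool" where
  "ordered_orthonormal_eigensystem Q \<mu> z \<longleftrightarrow>
     (\<forall>k \<in> {1..CARD('n)}. Q *v z k = \<mu> k *\<^sub>R z k) \<and>
     (\<forall>k \<in> {1..CARD('n)}. \<forall>l \<in> {1..CARD('n)}. z k \<bullet> z l = (if k = l then 1 else 0)) \<and>
     (\<forall>k \<in> {1..CARD('n)}. \<forall>l \<in> {1..CARD('n)}. k \<le> l \<longrightarrow> \<mu> l \<le> \<mu> k)"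

text \<open>The coordinates of \<open>real ^ 'm\<close> are numbered \<open>1, \<dots>, CARD('m)\<close> along the order of \<open>'m\<close>.\<close>

definition coord_number :: "'m::{finite, linorder} \<Rightarrow> nat" where
  "coord_number k = card {..k}"

lemma coord_number_bij:
  "bij_betw (coord_number :: 'm::{finite, linorder} \<Rightarrow> nat) UNIV {1..CARD('m)}"
proof -
  have "strict_mono (coord_number :: 'm \<Rightarrow> nat)"
    unfolding coord_number_def strict_mono_def by (auto intro!: psubset_card_mono)
  then have inj: "inj (coord_number :: 'm \<Rightarrow> nat)"
    by (rule strict_mono_imp_inj_on)
  have "range (coord_number :: 'm \<Rightarrow> nat) \<subseteq> {1..CARD('m)}"
    by (auto simp: coord_number_def Suc_le_eq card_gt_0_iff intro!: card_mono)
  moreover have "card (range (coord_number :: 'm \<Rightarrow> nat)) = card {1..CARD('m)}"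
    using inj by (simp add: card_image)
  ultimately have "range (coord_number :: 'm \<Rightarrow> nat) = {1..CARD('m)}"
    by (intro card_subset_eq) auto
  with inj show ?thesis
    by (simp add: bij_betw_def)
qed

definition simplex_vertex ::
  "(nat \<Rightarrow> real) \<Rightarrow> (nat \<Rightarrow> real ^ 'n) \<Rightarrow> 'n \<Rightarrow> real ^ 'm::{finite, linorder}" where
  "simplex_vertex \<mu> z i = (\<chi> k. z (coord_number k) $ i * sqrt (\<mu> (coord_number k)))"

definition graph_simplex ::
  "(nat \<Rightarrow> real) \<Rightarrow> (nat \<Rightarrow> real ^ 'n) \<Rightarrow> (real ^ 'm::{finite, linorder}) set" where
  "graph_simplex \<mu> z = convex hull (range (simplex_vertex \<mu> z))"

definition centroid :: "('n \<Rightarrow> 'v::real_vector) \<Rightarrow> 'n set \<Rightarrow> 'v" where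
  "centroid s V = (1 / real (card V)) *\<^sub>R (\<Sum>i\<in>V. s i)"

end

(* With the indicator vector 1_V of V, the vector V c_V has squared norm
   sum_{k<N} mu_k (z_k . 1_V)^2. The missing term k = N vanishes because the Laplacian Q is positive
   semidefinite and kills the constant vector, so that mu_N = 0. Hence the sum is the quadratic form
   1_V . Q 1_V, which is the cut size. *)

theory Submission
  imports Defs
begin

text \<open>Spreading the degree over the links at \<open>i\<close> turns a row of the Laplacian
  into weighted differences, which makes it visible that constant vectors are killed.\<close>

lemma laplacian_mult_vector_nth:
  assumes "weighted_graph L w"
  shows "(laplacian L w *v x) $ i = (\<Sum>j | (i, j) \<in> L. w i j * (x $ i - x $ j))"
proof -
  have no_loop: "(i, i) \<notin> L"
    using assms by (auto simp: weighted_graph_def irrefl_def)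
  have "(laplacian L w *v x) $ i
      = (\<Sum>j\<in>UNIV. (if j = i then degree L w i * x $ i else 0) - (if (i, j) \<in> L then w i j * x $ j else 0))"
    using no_loop by (auto simp: matrix_vector_mult_def laplacian_def intro!: sum.cong)
  also have "\<dots> = degree L w i * x $ i - (\<Sum>j | (i, j) \<in> L. w i j * x $ j)"
    by (simp add: sum_subtractf sum.If_cases)
  also have "\<dots> = (\<Sum>j | (i, j) \<in> L. w i j * (x $ i - x $ j))"
    by (simp add: degree_def sum_distrib_right right_diff_distrib sum_subtractf)
  finally show ?thesis .
qed

text \<open>The form is left unsymmetrised on purpose: on an indicator vector, the factor
  \<open>x $ i * (x $ i - x $ j)\<close> singles out the links that leave the set.\<close>

lemma laplacian_quadratic_form:
  assumes "weighted_graph L w"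
  shows "x \<bullet> (laplacian L w *v x) = (\<Sum>(i, j)\<in>L. w i j * (x $ i * (x $ i - x $ j)))"
proof -
  have "x \<bullet> (laplacian L w *v x)
      = (\<Sum>i\<in>UNIV. \<Sum>j | (i, j) \<in> L. w i j * (x $ i * (x $ i - x $ j)))"
    by (simp add: inner_vec_def laplacian_mult_vector_nth[OF assms] sum_distrib_left mult.left_commute)
  also have "\<dots> = (\<Sum>(i, j)\<in>(SIGMA i:UNIV. {j. (i, j) \<in> L}). w i j * (x $ i * (x $ i - x $ j)))"
    by (rule sum.Sigma) auto
  also have "(SIGMA i:UNIV. {j. (i, j) \<in> L}) = L"
    by auto
  finally show ?thesis .
qed

text \<open>Both orientations of a link lie in \<open>L\<close>, so adding the form to its copy with
  \<open>i\<close> and \<open>j\<close> swapped gives a weighted sum of squares.\<close>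

lemma laplacian_positive_semidefinite:
  assumes "weighted_graph L w"
  shows "0 \<le> x \<bullet> (laplacian L w *v x)"
proof -
  let ?f = "\<lambda>i j. w i j * (x $ i * (x $ i - x $ j))"
  have sym: "sym L" and w: "\<And>i j. (i, j) \<in> L \<Longrightarrow> w i j = w j i \<and> w i j > 0"
    using assms by (auto simp: weighted_graph_def)
  have "(\<Sum>(i, j)\<in>L. ?f i j) = (\<Sum>(i, j)\<in>L. ?f j i)"
    using sym by (intro sum.reindex_bij_witness[of _ prod.swap prod.swap]) (auto dest: symD)
  then have "2 * (x \<bullet> (laplacian L w *v x)) = (\<Sum>(i, j)\<in>L. ?f i j) + (\<Sum>(i, j)\<in>L. ?f j i)"
    by (simp add: laplacian_quadratic_form[OF assms])
  also have "\<dots> = (\<Sum>(i, j)\<in>L. w i j * (x $ i - x $ j)\<^sup>2)"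
    unfolding sum.distrib[symmetric]
  proof (intro sum.cong refl, clarify)
    fix i j
    assume "(i, j) \<in> L"
    then have "w j i = w i j"
      using w[of i j] by simp
    then show "?f i j + ?f j i = w i j * (x $ i - x $ j)\<^sup>2"
      by (simp add: power2_eq_square algebra_simps)
  qed
  also have "\<dots> \<ge> 0"
    using w by (intro sum_nonneg) (auto simp: less_imp_le)
  finally show ?thesis by simp
qed

text \<open>For 0/1 entries, \<open>x $ i * (x $ i - x $ j)\<close> is 1 if \<open>i\<close> is in
  \<open>V\<close> and \<open>j\<close> is not, and 0 otherwise, so each cut link counts
  once.\<close>

lemma laplacian_quadratic_form_indicator:
  assumes "weighted_graph L w"
  shows "(\<chi> i. indicator V i) \<bullet> (laplacian L w *v (\<chi> i. indicator V i)) = cut_size L w V"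
proof -
  have "(\<chi> i. indicator V i) \<bullet> (laplacian L w *v (\<chi> i. indicator V i))
      = (\<Sum>(i, j)\<in>L. if i \<in> V \<and> j \<notin> V then w i j else 0)"
    unfolding laplacian_quadratic_form[OF assms]
    by (intro sum.cong) (auto simp: indicator_def)
  also have "\<dots> = (\<Sum>(i, j)\<in>L \<inter> V \<times> (- V). w i j)"
    by (intro sum.mono_neutral_cong_right) (auto split: if_splits)
  finally show ?thesis by (simp add: cut_size_def)
qed

lemma orthonormal_family_expand:
  fixes z :: "'k \<Rightarrow> 'a::euclidean_space"
  assumes "finite K" and "card K = DIM('a)"
    and orth: "\<And>k l. k \<in> K \<Longrightarrow> l \<in> K \<Longrightarrow> z k \<bullet> z l = (if k = l then 1 else 0)"
  shows "(\<Sum>k\<in>K. (x \<bullet> z k) *\<^sub>R z k) = x"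
proof -
  \<comment> \<open>Equal vectors at distinct indices would have inner product both 0 and 1.\<close>
  have inj: "inj_on z K"
    by (rule inj_onI) (metis orth zero_neq_one)
  have pw: "pairwise orthogonal (z ` K)"
    using orth by (auto simp: pairwise_def orthogonal_def)
  have unit: "norm v = 1" if "v \<in> z ` K" for v
    using that orth by (auto simp: norm_eq_sqrt_inner)
  then have "independent (z ` K)"
    \<comment> \<open>The instance at 0 keeps the zero vector out of the family, since its norm is
      not 1.\<close>
    using pw unit[of 0] by (intro pairwise_orthogonal_independent) auto
  moreover have "card (z ` K) = DIM('a)"
    using inj assms by (simp add: card_image)
  ultimately have "span (z ` K) = UNIV"
    by (simp flip: dim_eq_full add: dim_eq_card_independent)
  then have "(\<Sum>v\<in>z ` K. (x \<bullet> v) *\<^sub>R v) = x"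
    using pw unit assms(1) by (intro orthonormal_basis_expand) auto
  then show ?thesis
    by (simp add: sum.reindex[OF inj])
qed

text \<open>Expanding \<open>x\<close> in the orthonormal eigenbasis diagonalises the form.\<close>

lemma eigensystem_quadratic_form:
  fixes Q :: "real ^ 'n ^ 'n::finite"
  assumes "ordered_orthonormal_eigensystem Q \<mu> z"
  shows "x \<bullet> (Q *v x) = (\<Sum>k\<in>{1..CARD('n)}. \<mu> k * (z k \<bullet> x)\<^sup>2)"
proof -
  let ?K = "{1..CARD('n)}"
  have eig: "\<And>k. k \<in> ?K \<Longrightarrow> Q *v z k = \<mu> k *\<^sub>R z k"
    and orth: "\<And>k l. k \<in> ?K \<Longrightarrow> l \<in> ?K \<Longrightarrow> z k \<bullet> z l = (if k = l then 1 else 0)"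
    using assms by (auto simp: ordered_orthonormal_eigensystem_def)
  have "x = (\<Sum>k\<in>?K. (x \<bullet> z k) *\<^sub>R z k)"
    using orthonormal_family_expand[of ?K z x] orth by simp
  then have "Q *v x = Q *v (\<Sum>k\<in>?K. (x \<bullet> z k) *\<^sub>R z k)"
    by simp
  also have "\<dots> = (\<Sum>k\<in>?K. (x \<bullet> z k) *\<^sub>R (Q *v z k))"
    by (simp add: linear_sum[OF matrix_vector_mul_linear] linear_cmul[OF matrix_vector_mul_linear])
  also have "\<dots> = (\<Sum>k\<in>?K. (x \<bullet> z k) *\<^sub>R \<mu> k *\<^sub>R z k)"
    using eig by (intro sum.cong) auto
  finally show ?thesis
    by (auto simp: inner_sum_right power2_eq_square inner_commute intro!: sum.cong)
qed

text \<open>On the unit eigenvector \<open>z k\<close> the quadratic form takes the value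
  \<open>\<mu> k\<close>.\<close>

lemma laplacian_eigenvalue_nonneg:
  fixes L :: "('n::finite \<times> 'n) set"
  assumes "weighted_graph L w" "ordered_orthonormal_eigensystem (laplacian L w) \<mu> z"
    and "k \<in> {1..CARD('n)}"
  shows "0 \<le> \<mu> k"
  using laplacian_positive_semidefinite[OF assms(1), of "z k"] assms(2,3)
  by (auto simp: ordered_orthonormal_eigensystem_def)

text \<open>If the smallest eigenvalue were positive, the form would be positive definite, yet it
  vanishes on the all-ones vector.\<close>

lemma laplacian_last_eigenvalue:
  fixes L :: "('n::finite \<times> 'n) set"
  assumes "weighted_graph L w" "ordered_orthonormal_eigensystem (laplacian L w) \<mu> z"
  shows "\<mu> CARD('n) = 0"
proof (rule ccontr)
  let ?K = "{1..CARD('n)}"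
  assume "\<mu> CARD('n) \<noteq> 0"
  moreover have last: "CARD('n) \<in> ?K"
    by (simp add: Suc_le_eq)
  ultimately have "0 < \<mu> CARD('n)"
    using laplacian_eigenvalue_nonneg[OF assms] by (metis order_le_less)
  then have pos: "0 < \<mu> k" if "k \<in> ?K" for k
    using assms(2) that last unfolding ordered_orthonormal_eigensystem_def
    by (meson atLeastAtMost_iff less_le_trans)
  \<comment> \<open>The constant \<open>1\<close> of \<open>real ^ 'n\<close> is the vector with all
    entries 1.\<close>
  define e :: "real ^ 'n" where "e = 1"
  have "laplacian L w *v e = 0"
    by (simp add: vec_eq_iff laplacian_mult_vector_nth[OF assms(1)] e_def)
  then have "(\<Sum>k\<in>?K. \<mu> k * (z k \<bullet> e)\<^sup>2) = 0"
    using eigensystem_quadratic_form[OF assms(2), of e] by simp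
  then have "\<forall>k\<in>?K. \<mu> k * (z k \<bullet> e)\<^sup>2 = 0"
    using pos by (subst (asm) sum_nonneg_eq_0_iff) (simp_all add: less_imp_le)
  then have "\<forall>k\<in>?K. e \<bullet> z k = 0"
    using pos by (force simp: inner_commute)
  moreover have "(\<Sum>k\<in>?K. (e \<bullet> z k) *\<^sub>R z k) = e"
    using assms(2) by (intro orthonormal_family_expand) (auto simp: ordered_orthonormal_eigensystem_def)
  ultimately have "e = 0"
    by (metis (no_types, lifting) scaleR_zero_left sum.neutral)
  then show False
    by (simp add: e_def)
qed

text \<open>Stated for an arbitrary \<open>V\<close>, so that it serves a set and its complement
  alike. At the empty set both sides are 0, as division by zero gives 0.\<close>

lemma norm_centroid_squared:
  fixes L :: "('n::finite \<times> 'n) set"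
  assumes graph: "weighted_graph L w"
    and eig: "ordered_orthonormal_eigensystem (laplacian L w) \<mu> z"
    and card: "CARD('m::{finite, linorder}) = CARD('n) - 1"
  shows "(norm (centroid (simplex_vertex \<mu> z :: 'n \<Rightarrow> real ^ 'm::{finite, linorder}) V))\<^sup>2
    = cut_size L w V / (real (card V))\<^sup>2"
proof -
  define u :: "real ^ 'n" where "u = (\<chi> i. indicator V i)"
  let ?s = "simplex_vertex \<mu> z :: 'n \<Rightarrow> real ^ 'm::{finite, linorder}"
  let ?g = "\<lambda>k. \<mu> k * (z k \<bullet> u)\<^sup>2"
  \<comment> \<open>Summing the vertices over \<open>V\<close> pairs each eigenvector with the
    indicator vector \<open>u\<close>.\<close>
  have coord: "(\<Sum>i\<in>V. ?s i) $ k = (z (coord_number k) \<bullet> u) * sqrt (\<mu> (coord_number k))" for k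
  proof -
    have "z l \<bullet> u = (\<Sum>i\<in>V. z l $ i)" for l
      unfolding inner_vec_def u_def by (intro sum.mono_neutral_cong_right) auto
    then show ?thesis
      by (simp add: simplex_vertex_def sum_distrib_right)
  qed
  \<comment> \<open>The square of \<open>sqrt\<close> gives back the eigenvalue only when it is
    nonnegative.\<close>
  have nonneg: "0 \<le> \<mu> (coord_number k)" for k :: 'm
  proof (rule laplacian_eigenvalue_nonneg[OF graph eig])
    have "coord_number k \<in> {1..CARD('m)}"
      using coord_number_bij by (rule bij_betwE[THEN bspec]) simp
    then show "coord_number k \<in> {1..CARD('n)}"
      using card by auto
  qed
  have "(norm (\<Sum>i\<in>V. ?s i))\<^sup>2 = (\<Sum>k\<in>UNIV. ?g (coord_number (k :: 'm)))"
    unfolding power2_norm_eq_inner inner_vec_def[of "sum ?s V"]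
  proof (intro sum.cong refl)
    fix k :: 'm
    have "(\<Sum>i\<in>V. ?s i) $ k \<bullet> (\<Sum>i\<in>V. ?s i) $ k
        = (z (coord_number k) \<bullet> u)\<^sup>2 * (sqrt (\<mu> (coord_number k)))\<^sup>2"
      unfolding coord by (simp add: power2_eq_square)
    then show "(\<Sum>i\<in>V. ?s i) $ k \<bullet> (\<Sum>i\<in>V. ?s i) $ k = ?g (coord_number k)"
      using nonneg[of k] by simp
  qed
  also have "\<dots> = (\<Sum>k\<in>{1..CARD('m)}. ?g k)"
    using coord_number_bij by (rule sum.reindex_bij_betw)
  \<comment> \<open>The simplex has one coordinate fewer than there are eigenpairs; the added term
    carries the eigenvalue 0.\<close>
  also have "\<dots> = (\<Sum>k\<in>{1..CARD('n)}. ?g k)"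
  proof -
    have "CARD('n) = Suc CARD('m)"
      \<comment> \<open>Subtraction on naturals truncates, so \<open>CARD('n) > 0\<close> is what
        yields the successor equation.\<close>
      using card zero_less_card_finite[where 'a = 'n] by linarith
    then show ?thesis
      using laplacian_last_eigenvalue[OF graph eig] by simp
  qed
  also have "\<dots> = cut_size L w V"
    using laplacian_quadratic_form_indicator[OF graph, of V] eigensystem_quadratic_form[OF eig, of u]
    by (simp add: u_def)
  finally show ?thesis
    by (simp add: centroid_def power_divide)
qed

theorem mainTheorem4:
  fixes N :: nat
    and L :: "('n::finite \<times> 'n) set"
    and w :: "'n \<Rightarrow> 'n \<Rightarrow> real"
    and \<mu> :: "nat \<Rightarrow> real"
    and z :: "nat \<Rightarrow> real ^ 'n"
    and s :: "'n \<Rightarrow> real ^ 'm::{finite, linorder}"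
    and S :: "(real ^ 'm::{finite, linorder}) set"
    and V :: "'n set"
  assumes "CARD('n) = N" and "N \<ge> 2" and "CARD('m) = N - 1"
    and "weighted_graph L w" and "connected_graph L"
    and "ordered_orthonormal_eigensystem (laplacian L w) \<mu> z"
    and "s = simplex_vertex \<mu> z" and "S = graph_simplex \<mu> z"
    and "V \<noteq> {}" and "V \<noteq> UNIV"
  shows "(norm (centroid s V))\<^sup>2 = cut_size L w V / (real (card V))\<^sup>2
       \<and> (norm (centroid s (- V)))\<^sup>2 = cut_size L w (- V) / (real N - real (card V))\<^sup>2"
proof -
  have centroid_sq: "(norm (centroid s U))\<^sup>2 = cut_size L w U / (real (card U))\<^sup>2" for U
    using norm_centroid_squared assms by blast
  \<comment> \<open>\<open>card_mono\<close> gives \<open>card V \<le> N\<close>, so the truncated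
    difference agrees with the real one.\<close>
  have "real (card (- V)) = real N - real (card V)"
    using assms(1) card_mono[of UNIV V] by (simp add: Compl_eq_Diff_UNIV card_Diff_subset of_nat_diff)
  then show ?thesis
    using centroid_sq[of V] centroid_sq[of "- V"] by simp
qed

end
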